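(* The spectral curve of an equivariant constant mean curvature (cmc) torus in $\mathbb{S}^3$ has no double points in $\mathbb{C}^\times\setminus\mathbb{S}^1$; that is, there is no double point whose $\lambda$-value lies in $\mathbb{C}^\times\setminus\mathbb{S}^1$.
   Context: A surface in $\mathbb{S}^3$ is equivariant if it is preserved set-wise by a one-parameter group of isometries of $\mathbb{S}^3$. Equivariant cmc tori have spectral genus zero or one. Spectral curve. The spectral curve of a cmc torus in $\mathbb{S}^3$ is a hyperelliptic Riemann surface $Y$ with a degree-two meromorphic function $\lambda$ branched over $\lambda=0$ (point $y^+$) and $\lambda=\infty$ (point $y^-$), together with non-zero holomorphic functions $\mu_1,\mu_2$ on $Y\setminus\{y^\pm\}$ such that: (1) besides the hyperelliptic involution $\sigma$ there are anti-holomorphic involutions $\eta$ and $\varrho=\eta\sigma=\sigma\eta$, $\eta$ without fixed points, $\eta(y^+)=y^-$ (both cover $\lambda\mapsto\bar\lambda^{-1}$); (2) $\mu_i\circ\sigma=\mu_i^{-1}$, $\mu_i\circ\eta=\bar\mu_i$, $\mu_i\circ\varrho=\bar\mu_i^{-1}$; (3) the $d\ln\mu_i$ are of the second kind with double poles at $y^\pm$ and linearly independent singular parts there; (4) there are four fixed points $y_1,\sigma(y_1),y_3,\sigma(y_3)$ of $\varrho$ at which $\mu_1,\mu_2\in\{1,-1\}$. Explicit form. In spectral genus zero, $Y$ is $\nu^2=\lambda$ and $\ln\mu_j=2\pi(\beta_j\lambda-\bar\beta_j)/\nu$ with $\beta_1,\beta_2\in\mathbb{C}$ linearly independent over $\mathbb{R}$.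 In the equivariant spectral genus one case, $Y$ is $4\nu^2=(\lambda-q)(\lambda^{-1}-q)$ with $q\in(-1,1)\setminus\{0\}$, and $\ln\mu_j=\pi i(x_j\nu+p_{j0}\omega)$ with $x_j\in\mathbb{R}$, $p_{j0}\in\mathbb{Z}$, the vectors $(x_1,p_{10}),(x_2,p_{20})$ linearly independent. Here $\omega$ is the multi-valued function on $Y$, skew-symmetric under $\tau(\lambda,\nu)=(\lambda^{-1},\nu)$, with $d\omega=\frac{2E'-qK'(\lambda+\lambda^{-1})}{4\pi\nu}\frac{d\lambda}{i\lambda}$, where $K'=K(\sqrt{1-q^2})$ and $E'=E(\sqrt{1-q^2})$ are complete elliptic integrals of the first and second kind of modulus $\sqrt{1-q^2}$. A double point is a point of the spectral curve at which both $\mu_1$ and $\mu_2$ are unimodular, but at which the spectral curve is not branched. *)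

theory Defs
  imports
    "HOL-Complex_Analysis.Complex_Analysis"
    "HOL-Computational_Algebra.Computational_Algebra"
begin

type_synonym point = "complex \<times> complex"

definition lin_indep_pair :: "'a::real_vector \<Rightarrow> 'a \<Rightarrow> bool" where
  "lin_indep_pair u v \<longleftrightarrow> u \<noteq> v \<and> independent {u, v}"


section \<open>Hyperelliptic curves\<close>

text \<open>A hyperelliptic curve is given by \<open>\<nu>\<^sup>2 = a(\<lambda>)\<close> and its points are pairs \<open>(\<lambda>, \<nu>)\<close>.
  The set below is \<open>Y\<close> without the two points \<open>y\<^sup>+\<close>, \<open>y\<^sup>-\<close> over \<open>\<lambda> = 0\<close> and \<open>\<lambda> = \<infinity>\<close>.\<close>

definition punctured_curve :: "(complex \<Rightarrow> complex) \<Rightarrow> point set" where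
  "punctured_curve a = {(l, n). l \<noteq> 0 \<and> n\<^sup>2 = a l}"

text \<open>On \<open>\<lambda> \<noteq> 0\<close>, \<open>a\<close> is a Laurent polynomial with simple zeros (the affine curve is smooth).
  Its order is \<open>k\<close> at \<open>\<lambda> = 0\<close> and \<open>- (degree p + k)\<close> at \<open>\<lambda> = \<infinity>\<close>; both are odd exactly if
  \<open>\<lambda>\<close> is branched there.\<close>

definition hyperelliptic :: "(complex \<Rightarrow> complex) \<Rightarrow> bool" where
  "hyperelliptic a \<longleftrightarrow> (\<exists>p k. rsquarefree p \<and> poly p 0 \<noteq> 0 \<and> odd k \<and> odd (int (degree p) + k) \<and>
     (\<forall>l. l \<noteq> 0 \<longrightarrow> a l = l powi k * poly p l))"

definition sigma :: "point \<Rightarrow> point" where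
  "sigma P = (fst P, - snd P)"

text \<open>A function on the smooth curve \<open>Y\<close> is holomorphic iff its composition with every
  holomorphic map from a planar domain to \<open>Y\<close> (in particular with every inverse chart) is.\<close>

definition holomorphic_on_curve :: "(point \<Rightarrow> complex) \<Rightarrow> point set \<Rightarrow> bool" where
  "holomorphic_on_curve f Y \<longleftrightarrow>
     (\<forall>U l n. open U \<and> l holomorphic_on U \<and> n holomorphic_on U \<and> (\<forall>z\<in>U. (l z, n z) \<in> Y)
        \<longrightarrow> (\<lambda>z. f (l z, n z)) holomorphic_on U)"

text \<open>Behaviour of \<open>d ln \<mu>\<^sub>1\<close> and \<open>d ln \<mu>\<^sub>2\<close> at one of the points \<open>y\<^sup>\<plusminus>\<close>.  Since \<open>\<lambda>\<close> is branched
  there, a local coordinate \<open>z\<close> is given by \<open>\<lambda> = e z\<close> with \<open>e z = z\<^sup>2\<close> at \<open>y\<^sup>+\<close> and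
  \<open>e z = 1 / z\<^sup>2\<close> at \<open>y\<^sup>-\<close>.  Each differential is \<open>(c / z\<^sup>2 + h(z)) dz\<close> with \<open>c \<noteq> 0\<close> and \<open>h\<close>
  holomorphic, i.e. has a double pole without residue.  The singular parts are linearly
  independent over the reals (over the complex numbers they never are).\<close>

definition double_poles_at ::
    "point set \<Rightarrow> (complex \<Rightarrow> complex) \<Rightarrow> (point \<Rightarrow> complex) \<Rightarrow> (point \<Rightarrow> complex) \<Rightarrow> bool" where
  "double_poles_at Y e mu1 mu2 \<longleftrightarrow>
     (\<exists>r>0. \<exists>n c1 c2 h1 h2.
        n holomorphic_on ball 0 r - {0} \<and> (\<forall>z\<in>ball 0 r - {0}. (e z, n z) \<in> Y) \<and>
        h1 holomorphic_on ball 0 r \<and> h2 holomorphic_on ball 0 r \<and>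
        c1 \<noteq> 0 \<and> c2 \<noteq> 0 \<and> lin_indep_pair c1 c2 \<and>
        (\<forall>z\<in>ball 0 r - {0}.
           deriv (\<lambda>w. mu1 (e w, n w)) z / mu1 (e z, n z) = c1 / z\<^sup>2 + h1 z \<and>
           deriv (\<lambda>w. mu2 (e w, n w)) z / mu2 (e z, n z) = c2 / z\<^sup>2 + h2 z))"


section \<open>Spectral curves of cmc tori in the 3-sphere\<close>

text \<open>The involution \<open>\<eta>\<close> is given on \<open>Y\<close> without \<open>y\<^sup>\<plusminus>\<close>; as it covers \<open>\<lambda> \<mapsto> 1 / cnj \<lambda>\<close>,
  it extends to the two points by interchanging them.\<close>

locale spectral_curve =
  fixes a :: "complex \<Rightarrow> complex"
    and eta :: "point \<Rightarrow> point"
    and mu1 mu2 :: "point \<Rightarrow> complex"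
  assumes hyperelliptic: "hyperelliptic a"
    and eta_mem: "\<And>P. P \<in> punctured_curve a \<Longrightarrow> eta P \<in> punctured_curve a"
    and eta_involution: "\<And>P. P \<in> punctured_curve a \<Longrightarrow> eta (eta P) = P"
    and eta_antiholomorphic:
      "holomorphic_on_curve (\<lambda>P. cnj (fst (eta P))) (punctured_curve a)"
      "holomorphic_on_curve (\<lambda>P. cnj (snd (eta P))) (punctured_curve a)"
    and eta_sigma: "\<And>P. P \<in> punctured_curve a \<Longrightarrow> eta (sigma P) = sigma (eta P)"
    and eta_covers: "\<And>P. P \<in> punctured_curve a \<Longrightarrow> fst (eta P) = inverse (cnj (fst P))"
    and eta_no_fixed_point: "\<And>P. P \<in> punctured_curve a \<Longrightarrow> eta P \<noteq> P"
    and mu_holomorphic: "\<And>mu. mu \<in> {mu1, mu2} \<Longrightarrow> holomorphic_on_curve mu (punctured_curve a)"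
    and mu_nonzero: "\<And>mu P. mu \<in> {mu1, mu2} \<Longrightarrow> P \<in> punctured_curve a \<Longrightarrow> mu P \<noteq> 0"
    and mu_sigma:
      "\<And>mu P. mu \<in> {mu1, mu2} \<Longrightarrow> P \<in> punctured_curve a \<Longrightarrow> mu (sigma P) = inverse (mu P)"
    and mu_eta:
      "\<And>mu P. mu \<in> {mu1, mu2} \<Longrightarrow> P \<in> punctured_curve a \<Longrightarrow> mu (eta P) = cnj (mu P)"
    and mu_rho:
      "\<And>mu P. mu \<in> {mu1, mu2} \<Longrightarrow> P \<in> punctured_curve a
         \<Longrightarrow> mu (eta (sigma P)) = inverse (cnj (mu P))"
    and dlnmu_zero: "double_poles_at (punctured_curve a) (\<lambda>z. z\<^sup>2) mu1 mu2"
    and dlnmu_infinity: "double_poles_at (punctured_curve a) (\<lambda>z. inverse (z\<^sup>2)) mu1 mu2"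
    and closing:
      "\<exists>y1 y3. card {y1, sigma y1, y3, sigma y3} = 4 \<and>
         (\<forall>P\<in>{y1, sigma y1, y3, sigma y3}.
            P \<in> punctured_curve a \<and> eta (sigma P) = P \<and> mu1 P \<in> {1, -1} \<and> mu2 P \<in> {1, -1})"


section \<open>The multi-valued function \<open>\<omega>\<close>\<close>

definition elliptic_K :: "real \<Rightarrow> real" where
  "elliptic_K k = integral {0..pi/2} (\<lambda>t. 1 / sqrt (1 - k\<^sup>2 * (sin t)\<^sup>2))"

definition elliptic_E :: "real \<Rightarrow> real" where
  "elliptic_E k = integral {0..pi/2} (\<lambda>t. sqrt (1 - k\<^sup>2 * (sin t)\<^sup>2))"

text \<open>Integral of the differential \<open>f(\<lambda>, \<nu>) d\<lambda>\<close> along a path in the curve.\<close>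

definition curve_integral :: "(real \<Rightarrow> point) \<Rightarrow> (point \<Rightarrow> complex) \<Rightarrow> complex" where
  "curve_integral g f =
     integral {0..1} (\<lambda>t. f (g t) * vector_derivative (\<lambda>s. fst (g s)) (at t within {0..1}))"

text \<open>A multi-valued function is represented by its set of values at each point: continuing any
  one value at \<open>P\<close> along all paths from \<open>P\<close> to \<open>Q\<close> gives exactly the values at \<open>Q\<close>.\<close>

definition multivalued_primitive ::
    "point set \<Rightarrow> (point \<Rightarrow> complex) \<Rightarrow> (point \<Rightarrow> complex set) \<Rightarrow> bool" where
  "multivalued_primitive Y f W \<longleftrightarrow>
     (\<forall>P\<in>Y. W P \<noteq> {}) \<and>
     (\<forall>P\<in>Y. \<forall>Q\<in>Y. \<forall>w\<in>W P.
        W Q = {w + curve_integral g f | g.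
                 valid_path g \<and> path_image g \<subseteq> Y \<and> pathstart g = P \<and> pathfinish g = Q})"

definition genus_one_radicand :: "real \<Rightarrow> complex \<Rightarrow> complex" where
  "genus_one_radicand q l = (l - of_real q) * (inverse l - of_real q) / 4"

definition tau :: "point \<Rightarrow> point" where
  "tau P = (inverse (fst P), snd P)"

text \<open>The coefficient of \<open>d\<lambda>\<close> in \<open>d\<omega>\<close>.  The differential is holomorphic at the branch points
  \<open>\<nu> = 0\<close>, where \<open>\<lambda>\<close> is not a coordinate and the formula takes the value 0.  This does not
  affect integrals along paths through them: there the velocity of \<open>\<lambda>\<close> vanishes, and the
  parameters with \<open>\<nu> = 0\<close> and nonzero velocity of \<open>\<nu>\<close> form a countable set.\<close>

definition d_omega :: "real \<Rightarrow> point \<Rightarrow> complex" where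
  "d_omega q P = (let l = fst P; n = snd P;
       K' = of_real (elliptic_K (sqrt (1 - q\<^sup>2))); E' = of_real (elliptic_E (sqrt (1 - q\<^sup>2)))
     in (2 * E' - of_real q * K' * (l + inverse l)) / (4 * of_real pi * n) * (1 / (\<i> * l)))"

definition is_omega :: "real \<Rightarrow> (point \<Rightarrow> complex set) \<Rightarrow> bool" where
  "is_omega q W \<longleftrightarrow>
     multivalued_primitive (punctured_curve (genus_one_radicand q)) (d_omega q) W \<and>
     (\<forall>P \<in> punctured_curve (genus_one_radicand q). W (tau P) = uminus ` W P)"


section \<open>Equivariant spectral curves and double points\<close>

definition spectral_genus_zero ::
    "(complex \<Rightarrow> complex) \<Rightarrow> (point \<Rightarrow> complex) \<Rightarrow> (point \<Rightarrow> complex) \<Rightarrow> bool" where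
  "spectral_genus_zero a mu1 mu2 \<longleftrightarrow> a = (\<lambda>l. l) \<and>
     (\<exists>b1 b2. lin_indep_pair b1 b2 \<and>
       (\<forall>(l, n) \<in> punctured_curve a.
          mu1 (l, n) = exp (2 * of_real pi * (b1 * l - cnj b1) / n) \<and>
          mu2 (l, n) = exp (2 * of_real pi * (b2 * l - cnj b2) / n)))"

definition equivariant_spectral_genus_one ::
    "(complex \<Rightarrow> complex) \<Rightarrow> (point \<Rightarrow> complex) \<Rightarrow> (point \<Rightarrow> complex) \<Rightarrow> bool" where
  "equivariant_spectral_genus_one a mu1 mu2 \<longleftrightarrow>
     (\<exists>(q::real) W (x1::real) (x2::real) (p1::int) (p2::int).
        -1 < q \<and> q < 1 \<and> q \<noteq> 0 \<and> a = genus_one_radicand q \<and> is_omega q W \<and>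
        lin_indep_pair (x1, real_of_int p1) (x2, real_of_int p2) \<and>
        (\<forall>(l, n) \<in> punctured_curve a. \<forall>w \<in> W (l, n).
           mu1 (l, n) = exp (of_real pi * \<i> * (of_real x1 * n + of_int p1 * w)) \<and>
           mu2 (l, n) = exp (of_real pi * \<i> * (of_real x2 * n + of_int p2 * w))))"

definition equivariant_spectral_curve ::
    "(complex \<Rightarrow> complex) \<Rightarrow> (point \<Rightarrow> point) \<Rightarrow> (point \<Rightarrow> complex) \<Rightarrow> (point \<Rightarrow> complex) \<Rightarrow> bool" where
  "equivariant_spectral_curve a eta mu1 mu2 \<longleftrightarrow> spectral_curve a eta mu1 mu2 \<and>
     (spectral_genus_zero a mu1 mu2 \<or> equivariant_spectral_genus_one a mu1 mu2)"

text \<open>The branch points of \<open>\<lambda>\<close> are the fixed points of the hyperelliptic involution.\<close>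

definition double_point ::
    "(complex \<Rightarrow> complex) \<Rightarrow> (point \<Rightarrow> complex) \<Rightarrow> (point \<Rightarrow> complex) \<Rightarrow> point \<Rightarrow> bool" where
  "double_point a mu1 mu2 P \<longleftrightarrow>
     P \<in> punctured_curve a \<and> norm (mu1 P) = 1 \<and> norm (mu2 P) = 1 \<and> sigma P \<noteq> P"

end

theory Submission
  imports Defs
begin

text \<open>In genus zero, unimodularity of both \<open>\<mu>\<^sub>j\<close> at \<open>(\<nu>\<^sup>2, \<nu>)\<close> says that
  \<open>\<nu> - 1 / cnj \<nu>\<close> is orthogonal to two independent vectors, so \<open>norm \<nu> = 1\<close>.

  In genus one it says that \<open>\<nu>\<close> and all values of \<open>\<omega>\<close> at the point are real.  If
  \<open>norm \<lambda> \<noteq> 1\<close>, then \<open>\<lambda>\<close> is real as well.  By skew-symmetry the values at \<open>(1 / \<lambda>, \<nu>)\<close> are also real,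
  so \<open>d\<omega>\<close> has a real integral along the path over the real line from \<open>\<lambda>\<close> to \<open>1 / \<lambda>\<close>.
  But \<open>d\<omega>\<close> is imaginary there, and the integral does not vanish: for \<open>q \<lambda> < 0\<close> the
  integrand has no zero, and for \<open>q \<lambda> > 0\<close> the integral over the whole arc between the branch points
  \<open>q\<close> and \<open>1 / q\<close> is zero, while the integrand changes sign only from negative to positive and back,
  symmetrically under \<open>\<lambda> \<mapsto> 1 / \<lambda>\<close>.\<close>

section \<open>Linear independence over the reals\<close>

lemma lin_indep_pair_eq_0:
  assumes "lin_indep_pair u v" "a *\<^sub>R u + b *\<^sub>R v = 0"
  shows "a = 0 \<and> b = 0"
proof -
  have "independent {u, v}" "u \<noteq> v" using assms(1) by (auto simp: lin_indep_pair_def)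
  then have "(if w = u then a else b) = 0" if "w \<in> {u, v}" for w
    using independentD[of "{u, v}" "{u, v}" "\<lambda>w. if w = u then a else b" w] that assms(2) by auto
  from this[of u] this[of v] \<open>u \<noteq> v\<close> show ?thesis by auto
qed

text \<open>Cramer's rule: independence makes the determinant of the two rows nonzero.\<close>

lemma lin_indep_pair_det:
  fixes x1 x2 y1 y2 s t :: real
  assumes "lin_indep_pair (x1, y1) (x2, y2)" "x1 * s + y1 * t = 0" "x2 * s + y2 * t = 0"
  shows "s = 0" "t = 0"
proof -
  have nz: "x2 * y1 - x1 * y2 \<noteq> 0"
  proof
    assume d: "x2 * y1 - x1 * y2 = 0"
    \<comment> \<open>With zero determinant, \<open>(x2, - x1)\<close> and \<open>(y2, - y1)\<close>
      are both coefficients of vanishing combinations, so all four entries are zero and the first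
      vector vanishes.\<close>
    have "x2 *\<^sub>R (x1, y1) + (- x1) *\<^sub>R (x2, y2) = 0" using d by (simp add: zero_prod_def)
    from lin_indep_pair_eq_0[OF assms(1) this] have x: "x1 = 0" "x2 = 0" by auto
    have "y2 *\<^sub>R (x1, y1) + (- y1) *\<^sub>R (x2, y2) = 0"
      using d by (simp add: zero_prod_def mult.commute)
    from lin_indep_pair_eq_0[OF assms(1) this] have "y1 = 0" "y2 = 0" by auto
    with x show False using lin_indep_pair_eq_0[OF assms(1), of 1 0] by (simp add: zero_prod_def)
  qed
  have "(x2 * y1 - x1 * y2) * s = y1 * (x2 * s + y2 * t) - y2 * (x1 * s + y1 * t)"
    "(x2 * y1 - x1 * y2) * t = x2 * (x1 * s + y1 * t) - x1 * (x2 * s + y2 * t)"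
    by (simp_all add: algebra_simps)
  from this[unfolded assms(2,3)] nz show "s = 0" "t = 0" by simp_all
qed

text \<open>\<open>Re (b * z)\<close> is the inner product of \<open>b\<close> and
  \<open>cnj z\<close> in the real plane, and only zero is orthogonal to two independent vectors
  there.\<close>

lemma lin_indep_pair_complex:
  assumes "lin_indep_pair b c" "Re (b * z) = 0" "Re (c * z) = 0"
  shows "z = 0"
proof -
  have "lin_indep_pair (Re b, Im b) (Re c, Im c)"
  proof -
    have "b \<noteq> c" "independent {b, c}" using assms(1) by (auto simp: lin_indep_pair_def)
    define f where "f = (\<lambda>z. (Re z, Im z))"
    have "linear f" unfolding f_def by (auto intro!: linearI)
    moreover have "inj f" unfolding f_def by (auto intro!: injI complex_eqI)
    ultimately have "independent (f ` {b, c})"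
      using linear_independent_injective_image \<open>independent {b, c}\<close> inj_on_subset by blast
    then show ?thesis using \<open>b \<noteq> c\<close> by (auto simp: lin_indep_pair_def f_def complex_eq_iff)
  qed
  moreover have "Re b * Re z + Im b * - Im z = 0" "Re c * Re z + Im c * - Im z = 0"
    using assms(2,3) by simp_all
  ultimately have "Re z = 0" "- Im z = 0" by (rule lin_indep_pair_det)+
  then show ?thesis by (simp add: complex_eq_iff)
qed

section \<open>Spectral genus zero\<close>

lemma spectral_genus_zero_unimodular:
  assumes "spectral_genus_zero a mu1 mu2" "(l, n) \<in> punctured_curve a"
    and "norm (mu1 (l, n)) = 1" "norm (mu2 (l, n)) = 1"
  shows "norm l = 1"
proof -
  obtain b1 b2 where a: "a = (\<lambda>l. l)" and ind: "lin_indep_pair b1 b2"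
    and mu: "mu1 (l, n) = exp (2 * of_real pi * (b1 * l - cnj b1) / n)"
      "mu2 (l, n) = exp (2 * of_real pi * (b2 * l - cnj b2) / n)"
    using assms(1,2) unfolding spectral_genus_zero_def by blast
  have l: "l = n\<^sup>2" "n \<noteq> 0" using assms(2) by (auto simp: punctured_curve_def a)
  have *: "Re (b * (n - 1 / cnj n)) = 0" if "norm (exp (2 * of_real pi * (b * l - cnj b) / n)) = 1" for b
  proof -
    \<comment> \<open>Inside the outer conjugation \<open>b\<close> itself stands unconjugated.
      Since conjugation keeps real parts, unimodularity becomes a single real-linear condition on
      \<open>b\<close>.\<close>
    have "2 * of_real pi * (b * l - cnj b) / n = of_real (2 * pi) * (b * n - cnj (b / cnj n))"
      using l by (simp add: field_simps power2_eq_square)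
    then have "Re (of_real (2 * pi) * (b * n - cnj (b / cnj n))) = 0" using that by simp
    then have "Re (b * n - cnj (b / cnj n)) = 0"
      unfolding Re_complex_of_real times_complex.sel by simp
    moreover have "Re (cnj (b / cnj n)) = Re (b / cnj n)" by (rule cnj.sel)
    ultimately show ?thesis by (simp add: right_diff_distrib del: complex_cnj_divide)
  qed
  have "n - 1 / cnj n = 0"
    using lin_indep_pair_complex[OF ind] * mu assms(3,4) by metis
  then have "n * cnj n = 1" using l by (simp add: field_simps)
  then have "(norm n)\<^sup>2 = 1" by (metis complex_norm_square of_real_eq_1_iff)
  then show ?thesis using l by (simp add: norm_power)
qed

section \<open>Integrals along real paths\<close>

text \<open>At real points the only non-real factor of \<open>d_omega\<close> is
  \<open>1 / (\<i> * l)\<close>, so the integral is \<open>- \<i>\<close> times a real one. The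
  derivatives are two-sided even at 0 and 1, as \<open>C1_differentiable_on\<close> demands.\<close>

lemma curve_integral_real_path:
  fixes x y x' y' :: "real \<Rightarrow> real" and q :: real
  defines "g \<equiv> \<lambda>t. (complex_of_real (x t), complex_of_real (y t))"
    and "K \<equiv> elliptic_K (sqrt (1 - q\<^sup>2))" and "E \<equiv> elliptic_E (sqrt (1 - q\<^sup>2))"
  assumes x: "\<And>t. t \<in> {0..1} \<Longrightarrow> (x has_real_derivative x' t) (at t)" "continuous_on {0..1} x'"
    and y: "\<And>t. t \<in> {0..1} \<Longrightarrow> (y has_real_derivative y' t) (at t)" "continuous_on {0..1} y'"
    and int: "((\<lambda>t. (2 * E - q * K * (x t + inverse (x t))) / (4 * pi * y t * x t) * x' t)
        has_integral J) {0..1}"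
  shows "valid_path g" "curve_integral g (d_omega q) = - \<i> * of_real J"
proof -
  have dx: "((\<lambda>t. complex_of_real (x t)) has_vector_derivative of_real (x' t)) (at t)"
    if "t \<in> {0..1}" for t
    using x(1)[OF that] has_vector_derivative_of_real
      by blast
  have dy: "((\<lambda>t. complex_of_real (y t)) has_vector_derivative of_real (y' t)) (at t)"
    if "t \<in> {0..1}" for t
    using y(1)[OF that] has_vector_derivative_of_real
      by blast
  have "g C1_differentiable_on {0..1}"
    unfolding C1_differentiable_on_def
  proof (intro exI conjI ballI)
    show "(g has_vector_derivative (of_real (x' t), of_real (y' t))) (at t)" if "t \<in> {0..1}" for t
      unfolding g_def by (intro has_vector_derivative_Pair dx dy that)
    show "continuous_on {0..1} (\<lambda>t. (complex_of_real (x' t), complex_of_real (y' t)))"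
      by (intro continuous_intros x y)
  qed
  then show "valid_path g"
    by (simp add: valid_path_def C1_differentiable_imp_piecewise)
  have "((\<lambda>t. - \<i> * of_real ((2 * E - q * K * (x t + inverse (x t))) / (4 * pi * y t * x t) * x' t))
      has_integral - \<i> * of_real J) {0..1}"
    by (intro has_integral_mult_right has_integral_of_real int)
  then have "((\<lambda>t. d_omega q (g t) * vector_derivative (\<lambda>s. fst (g s)) (at t within {0..1}))
      has_integral - \<i> * of_real J) {0..1}"
  proof (rule has_integral_eq[rotated])
    fix t :: real assume t: "t \<in> {0..1}"
    have "vector_derivative (\<lambda>s. fst (g s)) (at t within {0..1}) = of_real (x' t)"
      unfolding g_def fst_conv using vector_derivative_at_within_ivl[OF dx[OF t]] t by simp
    \<comment> \<open>At \<open>z = 0\<close> both sides are 0 by the convention for division, so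
      the identity applies to every \<open>x t\<close>.\<close>
    moreover have i_div: "1 / (\<i> * z) = - \<i> / z" for z
      by (cases "z = 0") (simp_all add: field_simps)
    ultimately show "- \<i> * of_real ((2 * E - q * K * (x t + inverse (x t))) / (4 * pi * y t * x t) * x' t)
      = d_omega q (g t) * vector_derivative (\<lambda>s. fst (g s)) (at t within {0..1})"
      using i_div[of "of_real (x t)"] by (simp add: d_omega_def Let_def g_def K_def E_def)
  qed
  then show "curve_integral g (d_omega q) = - \<i> * of_real J"
    unfolding curve_integral_def by (rule integral_unique)
qed

text \<open>A continuous nonnegative function with integral zero vanishes on the whole interval,
  which its value at \<open>c\<close> excludes.\<close>

lemma integral_pos_real:
  fixes f :: "real \<Rightarrow> real"
  assumes "continuous_on {a..b} f" "\<And>x. x \<in> {a..b} \<Longrightarrow> f x \<ge> 0" "a < b" "c \<in> {a..b}" "f c > 0"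
  shows "integral {a..b} f > 0"
  using assms integral_nonneg[OF integrable_continuous_real[OF assms(1)]]
    integral_eq_0_iff[of a b f]
  by (metis less_eq_real_def less_irrefl)

section \<open>Complete elliptic integrals in Legendre's form\<close>

text \<open>The square root in Legendre's integrals at modulus \<open>sqrt (1 - q\<^sup>2)\<close>.
  On \<open>{0..pi/2}\<close> it decreases from 1 to \<open>\<bar>q\<bar>\<close>, so its square
  divided by \<open>q\<close> runs through the real arc from \<open>1 / q\<close> to
  \<open>q\<close>.\<close>

definition legendre_delta :: "real \<Rightarrow> real \<Rightarrow> real" where
  "legendre_delta q t = sqrt (1 - (1 - q\<^sup>2) * (sin t)\<^sup>2)"

locale genus_one_parameter =
  fixes q :: real
  assumes q: "-1 < q" "q < 1" "q \<noteq> 0"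
begin

lemma q_sq: "0 < q\<^sup>2" "q\<^sup>2 < 1"
  using q by (auto simp: abs_square_less_1)

lemma legendre_radicand_pos: "0 < 1 - (1 - q\<^sup>2) * (sin t)\<^sup>2"
proof -
  have "(1 - q\<^sup>2) * (sin t)\<^sup>2 \<le> 1 - q\<^sup>2"
    using q_sq abs_square_le_1[of "sin t"] by (intro mult_left_le) simp_all
  also have "\<dots> < 1" using q_sq by simp
  finally show ?thesis by simp
qed

lemma legendre_delta_pos: "0 < legendre_delta q t"
  using legendre_radicand_pos by (simp add: legendre_delta_def)

lemma legendre_delta_nonzero: "legendre_delta q t \<noteq> 0"
  using legendre_delta_pos[of t] by simp

lemma legendre_delta_sq: "(legendre_delta q t)\<^sup>2 = 1 - (1 - q\<^sup>2) * (sin t)\<^sup>2"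
  using legendre_radicand_pos[of t] by (simp add: legendre_delta_def)

lemma legendre_delta_antimono:
  assumes "0 \<le> s" "s < t" "t \<le> pi / 2"
  shows "legendre_delta q t < legendre_delta q s"
proof -
  have "sin s < sin t" using assms by (intro sin_monotone_2pi) auto
  moreover have "0 \<le> sin s" using assms by (intro sin_ge_zero) auto
  ultimately have "(sin s)\<^sup>2 < (sin t)\<^sup>2" by (simp add: power_strict_mono)
  then show ?thesis using q_sq by (simp add: legendre_delta_def)
qed

lemma DERIV_legendre_delta [derivative_intros]:
  assumes "(f has_real_derivative f') (at x within A)"
  shows "((\<lambda>x. legendre_delta q (f x)) has_real_derivative
    - ((1 - q\<^sup>2) * sin (f x) * cos (f x) / legendre_delta q (f x) * f')) (at x within A)"
  unfolding legendre_delta_def using legendre_radicand_pos[of "f x"]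
  by (auto intro!: derivative_eq_intros assms simp: field_simps)

lemma continuous_on_legendre_delta [continuous_intros]:
  fixes f :: "real \<Rightarrow> real"
  shows "continuous_on A f \<Longrightarrow> continuous_on A (\<lambda>x. legendre_delta q (f x))"
  unfolding legendre_delta_def by (intro continuous_intros)

lemma elliptic_K_delta: "elliptic_K (sqrt (1 - q\<^sup>2)) = integral {0..pi/2} (\<lambda>t. 1 / legendre_delta q t)"
  and elliptic_E_delta: "elliptic_E (sqrt (1 - q\<^sup>2)) = integral {0..pi/2} (legendre_delta q)"
  using q_sq by (simp_all add: elliptic_K_def elliptic_E_def legendre_delta_def[abs_def])

lemma elliptic_K_pos: "elliptic_K (sqrt (1 - q\<^sup>2)) > 0"
  unfolding elliptic_K_delta
  by (intro integral_pos_real[where c = 0] continuous_intros)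
    (auto simp: legendre_delta_nonzero legendre_delta_pos less_imp_le)

lemma elliptic_E_pos: "elliptic_E (sqrt (1 - q\<^sup>2)) > 0"
  unfolding elliptic_E_delta using legendre_delta_pos
  by (intro integral_pos_real[where c = 0] continuous_on_legendre_delta) (auto simp: less_imp_le)

text \<open>\<open>(1 - q\<^sup>2) sin t cos t / \<Delta>\<close>, with \<open>\<Delta> = legendre_delta q t\<close>, is a primitive of \<open>\<Delta> - q\<^sup>2 / \<Delta>\<^sup>3\<close> vanishing at both ends.\<close>

lemma has_integral_elliptic_E_cubed:
  "((\<lambda>t. q\<^sup>2 / legendre_delta q t ^ 3) has_integral elliptic_E (sqrt (1 - q\<^sup>2))) {0..pi/2}"
proof -
  have "((\<lambda>t. legendre_delta q t - q\<^sup>2 / legendre_delta q t ^ 3) has_integral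
      (1 - q\<^sup>2) * sin (pi/2) * cos (pi/2) / legendre_delta q (pi/2)
      - (1 - q\<^sup>2) * sin 0 * cos 0 / legendre_delta q 0) {0..pi/2}"
  proof (rule fundamental_theorem_of_calculus)
    fix t :: real
    define s c d where "s = sin t" and "c = cos t" and "d = legendre_delta q t"
    have d: "d > 0" "d\<^sup>2 = 1 - (1 - q\<^sup>2) * s\<^sup>2" and c: "c\<^sup>2 = 1 - s\<^sup>2"
      using legendre_delta_pos legendre_delta_sq by (auto simp: s_def c_def d_def cos_squared_eq)
    \<comment> \<open>Divided by \<open>d ^ 3\<close>, the left side is the derivative of the
      primitive and the right side is the claimed integrand. Once \<open>c\<^sup>2\<close> and
      \<open>d\<^sup>2\<close> are expressed by \<open>s\<^sup>2\<close>, this is a polynomial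
      identity.\<close>
    have "(1 - q\<^sup>2) * ((c\<^sup>2 - s\<^sup>2) * d\<^sup>2 + (1 - q\<^sup>2) * s\<^sup>2 * c\<^sup>2) = (d\<^sup>2)\<^sup>2 - q\<^sup>2"
      unfolding c d by algebra
    then have "(1 - q\<^sup>2) * ((c\<^sup>2 - s\<^sup>2) * d\<^sup>2 + (1 - q\<^sup>2) * s\<^sup>2 * c\<^sup>2) / d ^ 3 = d - q\<^sup>2 / d ^ 3"
      using d(1) by (simp add: field_simps power2_eq_square power3_eq_cube)
    moreover have "(1 - q\<^sup>2) * ((c\<^sup>2 - s\<^sup>2) * d\<^sup>2 + (1 - q\<^sup>2) * s\<^sup>2 * c\<^sup>2) / d ^ 3
      = ((1 - q\<^sup>2) * (c * c + s * - s) * d - (1 - q\<^sup>2) * s * c * - ((1 - q\<^sup>2) * s * c / d)) / (d * d)"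
      using d(1) by (simp add: field_simps power2_eq_square power3_eq_cube)
    ultimately have *: "((1 - q\<^sup>2) * (c * c + s * - s) * d - (1 - q\<^sup>2) * s * c * - ((1 - q\<^sup>2) * s * c / d)) / (d * d)
      = d - q\<^sup>2 / d ^ 3" by simp
    have "((\<lambda>t. (1 - q\<^sup>2) * sin t * cos t / legendre_delta q t) has_real_derivative
      ((1 - q\<^sup>2) * (c * c + s * - s) * d - (1 - q\<^sup>2) * s * c * - ((1 - q\<^sup>2) * s * c / d)) / (d * d))
      (at t within {0..pi/2})"
      using d(1) by (auto intro!: derivative_eq_intros simp: s_def c_def d_def algebra_simps)
    then show "((\<lambda>t. (1 - q\<^sup>2) * sin t * cos t / legendre_delta q t) has_vector_derivative
      legendre_delta q t - q\<^sup>2 / legendre_delta q t ^ 3) (at t within {0..pi/2})"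
      unfolding * by (simp add: d_def has_real_derivative_iff_has_vector_derivative)
  qed auto
  then have *: "((\<lambda>t. legendre_delta q t - q\<^sup>2 / legendre_delta q t ^ 3) has_integral 0) {0..pi/2}"
    by simp
  have "(legendre_delta q has_integral elliptic_E (sqrt (1 - q\<^sup>2))) {0..pi/2}"
    unfolding elliptic_E_delta
    by (intro integrable_integral integrable_continuous_real continuous_intros)
  from has_integral_diff[OF this *] show ?thesis by simp
qed

text \<open>Up to the factor \<open>\<plusminus> \<i> / \<pi>\<close> this is \<open>d\<omega>\<close> along the real arc between the branch points, in the
  parametrisation \<open>\<lambda> = \<Delta>\<^sup>2 / q\<close>, \<open>\<nu> = \<plusminus> (1 - q\<^sup>2) sin t cos t / (2 \<Delta>)\<close>.\<close>

definition omega_density :: "real \<Rightarrow> real" where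
  "omega_density t = (2 * elliptic_E (sqrt (1 - q\<^sup>2)) - elliptic_K (sqrt (1 - q\<^sup>2)) *
     ((legendre_delta q t)\<^sup>2 + q\<^sup>2 / (legendre_delta q t)\<^sup>2)) / legendre_delta q t"

lemma continuous_on_omega_density: "continuous_on A omega_density"
  unfolding omega_density_def[abs_def]
  by (intro continuous_intros) (auto simp: legendre_delta_nonzero)

text \<open>The \<open>E\<close> term contributes \<open>2 * E * K\<close> and the \<open>K\<close>
  term \<open>K * (E + E)\<close>, because \<Delta> and \<open>q\<^sup>2 / \<Delta> ^ 3\<close> have
  the same integral \<open>E\<close>. The constants in \<open>d_omega\<close> are balanced so that
  this period vanishes.\<close>

lemma omega_density_has_integral: "(omega_density has_integral 0) {0..pi/2}"
proof -
  define K E where "K = elliptic_K (sqrt (1 - q\<^sup>2))" and "E = elliptic_E (sqrt (1 - q\<^sup>2))"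
  have K: "((\<lambda>t. 1 / legendre_delta q t) has_integral K) {0..pi/2}"
    unfolding elliptic_K_delta K_def
    by (intro integrable_integral integrable_continuous_real continuous_intros)
      (auto simp: legendre_delta_nonzero)
  have E: "(legendre_delta q has_integral E) {0..pi/2}"
    unfolding elliptic_E_delta E_def
    by (intro integrable_integral integrable_continuous_real continuous_intros)
  have "((\<lambda>t. 2 * E * (1 / legendre_delta q t)
      - K * (legendre_delta q t + q\<^sup>2 / legendre_delta q t ^ 3)) has_integral
      2 * E * K - K * (E + E)) {0..pi/2}"
    by (intro has_integral_diff has_integral_mult_right has_integral_add K E
        has_integral_elliptic_E_cubed[folded E_def])
  moreover have "2 * E * (1 / legendre_delta q t)
      - K * (legendre_delta q t + q\<^sup>2 / legendre_delta q t ^ 3) = omega_density t" for t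
    using legendre_delta_pos[of t]
    by (simp add: omega_density_def K_def E_def field_simps power2_eq_square power3_eq_cube)
  ultimately show ?thesis by simp
qed

section \<open>Sign of the integral between mutually inverse points of the arc\<close>

text \<open>By \<open>prod\<close>, the angles \<open>s\<close> and \<open>t\<close> belong to
  mutually inverse values of \<lambda>. The numerator \<open>N\<close> falls as
  \<open>D + q\<^sup>2 / D\<close> grows; this sum is equal at \<open>s\<close> and
  \<open>t\<close>, smaller between them and larger outside.\<close>

lemma integral_omega_density_pos:
  assumes st: "0 < s" "s < t" "t < pi / 2" and prod: "(legendre_delta q s)\<^sup>2 * (legendre_delta q t)\<^sup>2 = q\<^sup>2"
  shows "integral {s..t} omega_density > 0"
proof -
  define K E where "K = elliptic_K (sqrt (1 - q\<^sup>2))" and "E = elliptic_E (sqrt (1 - q\<^sup>2))"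
  define D where "D = (\<lambda>u. (legendre_delta q u)\<^sup>2)"
  define N where "N = (\<lambda>u. 2 * E - K * (D u + q\<^sup>2 / D u))"
  have D_pos: "D u > 0" for u by (simp add: D_def legendre_delta_nonzero)
  have Dprod: "q\<^sup>2 = D s * D t" using prod by (simp add: D_def)
  have D_less: "D v < D u" if "0 \<le> u" "u < v" "v \<le> pi/2" for u v
    unfolding D_def using legendre_delta_antimono[OF that] legendre_delta_pos[of v]
    by (intro power_strict_mono) auto
  have K: "K > 0" using elliptic_K_pos by (simp add: K_def)
  have dens: "omega_density u = N u / legendre_delta q u" for u
    by (simp add: omega_density_def N_def D_def K_def E_def)
  \<comment> \<open>As \<open>q\<^sup>2 = D s * D t\<close>, the change of
    \<open>D + q\<^sup>2 / D\<close> factors with roots \<open>D s\<close> and \<open>D t\<close>.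
    Monotonicity of \<open>D\<close> then gives the sign on each side.\<close>
  have diff: "N u = N s - K * ((D u - D s) * (D u - D t) / D u)" for u
  proof -
    have "D u + q\<^sup>2 / D u - (D s + q\<^sup>2 / D s) = (D u - D s) * (D u - D t) / D u"
      using D_pos[of u] D_pos[of s] Dprod by (simp add: field_simps)
    then have *: "D u + q\<^sup>2 / D u = D s + q\<^sup>2 / D s + (D u - D s) * (D u - D t) / D u"
      by linarith
    show ?thesis unfolding N_def * by (simp only: distrib_left diff_diff_eq)
  qed
  have N_inside: "N u > N s" if "s < u" "u < t" for u
  proof -
    have "(D u - D s) * (D u - D t) < 0"
      using that st D_less[of s u] D_less[of u t] by (intro mult_neg_pos) auto
    then show ?thesis using diff[of u] mult_pos_neg[OF K divide_neg_pos[OF _ D_pos[of u]]] by fastforce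
  qed
  have N_outside: "N u < N s" if "u \<in> {0..<s} \<union> {t<..pi/2}" for u
  proof -
    have "(D u - D s) * (D u - D t) > 0"
    proof (cases "u < s")
      case True
      then show ?thesis using that st D_less[of u s] D_less[of u t] by (intro mult_pos_pos) auto
    next
      case False
      then show ?thesis using that st D_less[of s u] D_less[of t u] by (intro mult_neg_neg) auto
    qed
    then show ?thesis using diff[of u] mult_pos_pos[OF K divide_pos_pos[OF _ D_pos[of u]]] by fastforce
  qed
  have N_t: "N t = N s" using diff[of t] by simp
  have int: "omega_density integrable_on {a..b}" for a b
    by (intro integrable_continuous_real continuous_on_omega_density)
  show ?thesis
  \<comment> \<open>The common value of \<open>N\<close> at \<open>s\<close> and \<open>t\<close>
    decides: if it is nonnegative, the density is positive between them; otherwise it is negative on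
    both outer intervals, and the vanishing total forces the middle integral to be positive.\<close>
  proof (cases "N s \<ge> 0")
    case True
    have "N u \<ge> 0" if "u \<in> {s..t}" for u
      using that True N_inside[of u] N_t by (cases "u = s"; cases "u = t") auto
    then have "omega_density u \<ge> 0" if "u \<in> {s..t}" for u
      using that legendre_delta_pos[of u] by (simp add: dens)
    moreover have "omega_density ((s + t) / 2) > 0"
      using True N_inside[of "(s + t) / 2"] st legendre_delta_pos by (simp add: dens)
    ultimately show ?thesis
      using st by (intro integral_pos_real[where c = "(s + t) / 2"] continuous_on_omega_density) auto
  next
    case False
    have "N u < 0" if "u \<in> {0..s} \<union> {t..pi/2}" for u
      using that False N_outside[of u] N_t by (cases "u = s"; cases "u = t") auto
    then have neg: "- omega_density u > 0" if "u \<in> {0..s} \<union> {t..pi/2}" for u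
      using that legendre_delta_pos[of u] by (simp add: dens divide_less_0_iff)
    have "integral {0..s} (\<lambda>u. - omega_density u) > 0"
      using st neg less_imp_le[OF neg]
      by (intro integral_pos_real[where c = s] continuous_on_minus continuous_on_omega_density) auto
    moreover have "integral {t..pi/2} (\<lambda>u. - omega_density u) > 0"
      using st neg less_imp_le[OF neg]
      by (intro integral_pos_real[where c = t] continuous_on_minus continuous_on_omega_density) auto
    moreover have "integral {0..s} omega_density + (integral {s..t} omega_density + integral {t..pi/2} omega_density) = 0"
      using st Henstock_Kurzweil_Integration.integral_combine[OF _ _ int, of s t "pi/2"]
        Henstock_Kurzweil_Integration.integral_combine[OF _ _ int, of 0 s "pi/2"]
        integral_unique[OF omega_density_has_integral] by simp
    ultimately show ?thesis by simp
  qed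
qed

section \<open>Paths over the real line from \<lambda> to its inverse\<close>

lemma legendre_delta_sq_surj:
  assumes "q\<^sup>2 < a" "a < 1"
  obtains s where "0 < s" "s < pi / 2" "(legendre_delta q s)\<^sup>2 = a"
proof -
  \<comment> \<open>\<open>r\<close> is the sine that solves
    \<open>1 - (1 - q\<^sup>2) * r\<^sup>2 = a\<close>; the strict bounds on \<open>a\<close> keep
    the angle away from the branch points.\<close>
  define r where "r = sqrt ((1 - a) / (1 - q\<^sup>2))"
  have r: "0 < r" "r < 1" "r\<^sup>2 = (1 - a) / (1 - q\<^sup>2)"
    using assms q_sq by (auto simp: r_def)
  show thesis
  proof (rule that)
    show "0 < arcsin r" "arcsin r < pi / 2"
      using r arcsin_less_arcsin[of 0 r] arcsin_less_arcsin[of r 1] by auto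
    show "(legendre_delta q (arcsin r))\<^sup>2 = a"
      using r q_sq by (simp add: legendre_delta_sq)
  qed
qed

lemma of_real_mem_genus_one_curve:
  "(complex_of_real x, complex_of_real y) \<in> punctured_curve (genus_one_radicand q) \<longleftrightarrow>
    x \<noteq> 0 \<and> 4 * y\<^sup>2 = (x - q) * (inverse x - q)"
proof -
  have "genus_one_radicand q (complex_of_real x) = of_real ((x - q) * (inverse x - q) / 4)"
    by (simp add: genus_one_radicand_def)
  then have "(complex_of_real y)\<^sup>2 = genus_one_radicand q (complex_of_real x) \<longleftrightarrow>
      y\<^sup>2 = (x - q) * (inverse x - q) / 4"
    by (metis of_real_eq_iff of_real_power)
  then show ?thesis by (auto simp: punctured_curve_def)
qed

text \<open>A real nonzero \<nu> forces \<open>\<bar>l\<bar> < 1 / \<bar>q\<bar>\<close>, so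
  \<open>l\<close> and \<open>inverse l\<close> lie on the open arc between the branch points. The
  path is the Legendre parametrisation with the angle running affinely from \<open>s\<close> to
  \<open>t\<close>; \<nu> never vanishes on it, so the sheet does not change.\<close>

lemma imaginary_omega_path_between_branch_points:
  assumes l: "1 < \<bar>l\<bar>" "0 < q * l" and n: "n \<noteq> 0" "4 * n\<^sup>2 = (l - q) * (inverse l - q)"
  shows "\<exists>g. valid_path g \<and> path_image g \<subseteq> punctured_curve (genus_one_radicand q) \<and>
    pathstart g = (of_real l, of_real n) \<and> pathfinish g = (of_real (inverse l), of_real n) \<and>
    Im (curve_integral g (d_omega q)) \<noteq> 0"
proof -
  define K E where "K = elliptic_K (sqrt (1 - q\<^sup>2))" and "E = elliptic_E (sqrt (1 - q\<^sup>2))"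
  \<comment> \<open>The values of \<Delta> squared required at \<lambda> equal to \<open>l\<close>
    and to \<open>inverse l\<close>.\<close>
  define a b where "a = q * l" and "b = q / l"
  have l0: "l \<noteq> 0" using l by auto
  have l2: "1 < l\<^sup>2" using l(1) by (simp add: abs_square_less_1 not_le[symmetric] abs_square_le_1)
  have ab: "a * b = q\<^sup>2" "a = b * l\<^sup>2" using l0 by (auto simp: a_def b_def power2_eq_square)
  have a0: "0 < a" using l by (simp add: a_def)
  have b0: "0 < b" using a0 ab l2 by (metis zero_less_mult_pos2 less_trans zero_less_one)
  have b_less: "b < a" using ab b0 l2 by simp
  have "b < 1"
  proof (rule ccontr)
    assume "\<not> b < 1"
    then have "1 * 1 \<le> a * b" using b_less by (intro mult_mono) auto
    then show False using ab q_sq by simp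
  qed
  \<comment> \<open>This is the curve equation in terms of \<open>a\<close> and \<open>b\<close>.
    With \<open>b < 1\<close> it bounds \<open>a\<close> by 1, and \<open>a * b = q\<^sup>2\<close>
    turns that into \<open>q\<^sup>2 < b\<close>.\<close>
  have "(1 - b) * (1 - a) = 4 * n\<^sup>2"
    using l0 n(2) by (simp add: a_def b_def field_simps)
  then have "0 < (1 - b) * (1 - a)" using n(1) by simp
  then have a1: "a < 1" using \<open>b < 1\<close> by (simp add: zero_less_mult_iff)
  have qb: "q\<^sup>2 < b" using a1 b0 ab(1) by (metis mult_strict_right_mono mult_1)
  obtain s where s: "0 < s" "s < pi / 2" "(legendre_delta q s)\<^sup>2 = a"
    using legendre_delta_sq_surj[of a] qb b_less a1 by auto
  obtain t where t: "0 < t" "t < pi / 2" "(legendre_delta q t)\<^sup>2 = b"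
    using legendre_delta_sq_surj[of b] qb \<open>b < 1\<close> by auto
  have "s < t"
  proof (rule ccontr)
    assume "\<not> s < t"
    then have "legendre_delta q s \<le> legendre_delta q t"
      using legendre_delta_antimono[of t s] s t by (cases "s = t") auto
    then have "a \<le> b" using legendre_delta_pos[of s] s t by (metis power_mono less_imp_le)
    then show False using b_less by simp
  qed
  define J where "J = integral {s..t} omega_density"
  have J: "J > 0" unfolding J_def
    using s t \<open>s < t\<close> ab by (intro integral_omega_density_pos) auto
  \<comment> \<open>The parametrisation gives \<nu> only up to sign; \<open>e\<close> selects the
    sheet that contains \<open>n\<close>.\<close>
  define e where "e = sgn n"
  have e: "e * e = 1" "e \<noteq> 0" using n(1) by (auto simp: e_def sgn_if)
  define m where "m = t - s"
  define ph where "ph = (\<lambda>u. m * u + s)"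
  define x y where "x = (\<lambda>u. (legendre_delta q (ph u))\<^sup>2 / q)"
    and "y = (\<lambda>u. e * ((1 - q\<^sup>2) * sin (ph u) * cos (ph u) / (2 * legendre_delta q (ph u))))"
  define x' y' where "x' = (\<lambda>u. - (2 * (1 - q\<^sup>2) * sin (ph u) * cos (ph u) / q * m))"
    and "y' = (\<lambda>u. e * ((1 - q\<^sup>2) / 2 * ((cos (ph u))\<^sup>2 - (sin (ph u))\<^sup>2) / legendre_delta q (ph u)
      + (1 - q\<^sup>2)\<^sup>2 / 2 * (sin (ph u))\<^sup>2 * (cos (ph u))\<^sup>2 / legendre_delta q (ph u) ^ 3) * m)"
  have m: "m > 0" using \<open>s < t\<close> by (simp add: m_def)
  have ph: "0 < ph u" "ph u < pi / 2" if "u \<in> {0..1}" for u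
  proof -
    have "m * u \<le> m" "0 \<le> m * u" using that m by (auto intro: mult_left_le)
    then show "0 < ph u" "ph u < pi / 2" using s t by (auto simp: ph_def m_def)
  qed
  have sc: "sin (ph u) > 0" "cos (ph u) > 0" if "u \<in> {0..1}" for u
    using ph[OF that] by (auto intro: sin_gt_zero cos_gt_zero)
  have dph: "(ph has_real_derivative m) (at u)" for u
    unfolding ph_def by (auto intro!: derivative_eq_intros)
  have cph: "continuous_on A ph" for A
    unfolding ph_def by (intro continuous_intros)
  have dx: "(x has_real_derivative x' u) (at u)" for u
    unfolding x_def x'_def using q legendre_delta_nonzero
    by (auto intro!: derivative_eq_intros dph)
  have dy: "(y has_real_derivative y' u) (at u)" for u
    unfolding y_def y'_def using legendre_delta_nonzero[of "ph u"]
    by (auto intro!: derivative_eq_intros dph simp: field_simps power2_eq_square power3_eq_cube)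
  have cx: "continuous_on {0..1} x'" unfolding x'_def by (intro continuous_intros cph) (use q in auto)
  have cy: "continuous_on {0..1} y'"
    unfolding y'_def by (intro continuous_intros cph) (auto simp: legendre_delta_nonzero)
  have curve: "x u \<noteq> 0 \<and> 4 * (y u)\<^sup>2 = (x u - q) * (inverse (x u) - q)" for u
  proof -
    define d where "d = legendre_delta q (ph u)"
    have d: "d \<noteq> 0" "d\<^sup>2 = 1 - (1 - q\<^sup>2) * (sin (ph u))\<^sup>2" "d\<^sup>2 - q\<^sup>2 = (1 - q\<^sup>2) * (cos (ph u))\<^sup>2"
      by (auto simp: d_def legendre_delta_nonzero legendre_delta_sq cos_squared_eq algebra_simps)
    have "(x u - q) * (inverse (x u) - q) = (d\<^sup>2 - q\<^sup>2) * (1 - d\<^sup>2) / d\<^sup>2"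
      using q d(1) by (simp add: x_def d_def[symmetric] field_simps power2_eq_square)
    also have "\<dots> = ((1 - q\<^sup>2) * (cos (ph u))\<^sup>2) * ((1 - q\<^sup>2) * (sin (ph u))\<^sup>2) / d\<^sup>2"
      unfolding d(3) by (simp add: d(2))
    also have "\<dots> = (e * e) * (((1 - q\<^sup>2) * (cos (ph u))\<^sup>2) * ((1 - q\<^sup>2) * (sin (ph u))\<^sup>2) / d\<^sup>2)"
      by (simp add: e)
    also have "\<dots> = 4 * (y u)\<^sup>2"
      by (simp add: y_def d_def[symmetric] power2_eq_square)
    finally show ?thesis using q d(1) by (auto simp: x_def d_def)
  qed
  have x_end: "x 0 = l" "x 1 = inverse l"
    using q s t l0 by (auto simp: x_def ph_def m_def a_def b_def field_simps)
  \<comment> \<open>The curve equation fixes \<open>y\<close> at both ends up to sign, and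
    \<open>e * y u > 0\<close> settles the sign.\<close>
  have n_eq: "y u = n" if "u \<in> {0..1}" "4 * (y u)\<^sup>2 = 4 * n\<^sup>2" for u
  proof -
    have "e * y u = (e * e) * ((1 - q\<^sup>2) * sin (ph u) * cos (ph u) / (2 * legendre_delta q (ph u)))"
      by (simp add: y_def)
    then have "e * y u > 0" using sc[OF that(1)] q_sq legendre_delta_pos by (simp add: e)
    moreover have "y u = n \<or> y u = - n" using that(2) by (simp add: power2_eq_iff)
    ultimately show ?thesis by (auto simp: e_def sgn_if split: if_splits)
  qed
  have y_end: "y 0 = n" "y 1 = n"
    using n_eq[of 0] n_eq[of 1] curve[of 0] curve[of 1] x_end n(2) by (auto simp: mult.commute)
  have "((\<lambda>u. omega_density (m *\<^sub>R u + s)) has_integral J /\<^sub>R m ^ DIM(real))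
      (cbox ((s - s) /\<^sub>R m) ((t - s) /\<^sub>R m))"
    unfolding J_def using m
    by (intro has_integral_affinity')
      (auto intro!: integrable_integral integrable_continuous_real continuous_on_omega_density)
  then have "((\<lambda>u. omega_density (ph u)) has_integral J / m) {0..1}"
    using m by (simp add: ph_def m_def divide_inverse mult.commute)
  then have "((\<lambda>u. - (m * e / pi) * omega_density (ph u)) has_integral - (m * e / pi) * (J / m)) {0..1}"
    by (rule has_integral_mult_right)
  \<comment> \<open>The factor sin cos in \<open>x'\<close> cancels the one in \<open>y\<close>,
    which leaves a constant multiple of the density.\<close>
  moreover have "- (m * e / pi) * omega_density (ph u)
      = (2 * E - q * K * (x u + inverse (x u))) / (4 * pi * y u * x u) * x' u" if "u \<in> {0..1}" for u
  proof -
    define d where "d = legendre_delta q (ph u)"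
    define w where "w = 2 * E - K * (d\<^sup>2 + q\<^sup>2 / d\<^sup>2)"
    define p where "p = (1 - q\<^sup>2) * sin (ph u) * cos (ph u)"
    have d: "d \<noteq> 0" by (simp add: d_def legendre_delta_nonzero)
    have p: "p \<noteq> 0" using sc[OF that] q_sq by (simp add: p_def)
    have 1: "omega_density (ph u) = w / d"
      by (simp add: omega_density_def w_def d_def K_def E_def)
    have 2: "2 * E - q * K * (x u + inverse (x u)) = w"
      using q by (simp add: w_def x_def d_def field_simps power2_eq_square)
    have 3: "x u = d\<^sup>2 / q" "y u = e * (p / (2 * d))" "x' u = - (2 * p / q * m)"
      by (simp_all add: x_def y_def x'_def d_def p_def mult.assoc)
    have 4: "inverse e = e" using e by (metis inverse_unique)
    have "w / (4 * pi * (e * (p / (2 * d))) * (d\<^sup>2 / q)) * - (2 * p / q * m) = - (m * inverse e / pi) * (w / d)"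
      using d p q e by (simp add: field_simps power2_eq_square)
    then show ?thesis unfolding 1 2 unfolding 3 4 by simp
  qed
  ultimately have int: "((\<lambda>u. (2 * E - q * K * (x u + inverse (x u))) / (4 * pi * y u * x u) * x' u)
      has_integral - (m * e / pi) * (J / m)) {0..1}"
    by (rule has_integral_eq[rotated]) auto
  note path = curve_integral_real_path[OF dx cx dy cy int[unfolded K_def E_def]]
  define g where "g = (\<lambda>u. (complex_of_real (x u), complex_of_real (y u)))"
  have "valid_path g" "Im (curve_integral g (d_omega q)) = m * e / pi * (J / m)"
    using path by (simp_all add: g_def)
  moreover have "path_image g \<subseteq> punctured_curve (genus_one_radicand q)"
    using curve by (auto simp: path_image_def g_def of_real_mem_genus_one_curve)
  moreover have "pathstart g = (of_real l, of_real n)" "pathfinish g = (of_real (inverse l), of_real n)"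
    using x_end y_end by (simp_all add: pathstart_def pathfinish_def g_def)
  moreover have "m * e / pi * (J / m) \<noteq> 0" using J m e by simp
  ultimately show ?thesis by (intro exI[of _ g]) simp
qed

text \<open>The straight segment from \<open>l\<close> to \<open>inverse l\<close> stays on the side
  of 0 opposite to \<open>q\<close>. There \<nu> squared and the numerator of \<open>d_omega\<close>
  are positive, so the integrand keeps one sign.\<close>

lemma imaginary_omega_path_off_branch_points:
  assumes l: "\<bar>l\<bar> \<noteq> 1" "q * l < 0" and n: "n \<noteq> 0" "4 * n\<^sup>2 = (l - q) * (inverse l - q)"
  shows "\<exists>g. valid_path g \<and> path_image g \<subseteq> punctured_curve (genus_one_radicand q) \<and>
    pathstart g = (of_real l, of_real n) \<and> pathfinish g = (of_real (inverse l), of_real n) \<and>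
    Im (curve_integral g (d_omega q)) \<noteq> 0"
proof -
  define K E where "K = elliptic_K (sqrt (1 - q\<^sup>2))" and "E = elliptic_E (sqrt (1 - q\<^sup>2))"
  have KE: "K > 0" "E > 0" using elliptic_K_pos elliptic_E_pos by (simp_all add: K_def E_def)
  have l0: "l \<noteq> 0" using l by auto
  define e where "e = sgn n"
  have e: "e * e = 1" "e \<noteq> 0" using n(1) by (auto simp: e_def sgn_if)
  define m where "m = inverse l - l"
  have m: "m \<noteq> 0"
  proof
    assume "m = 0"
    then have "l\<^sup>2 = 1" using l0 by (simp add: m_def field_simps power2_eq_square)
    then show False using l(1) by (simp add: abs_square_eq_1)
  qed
  define x where "x = (\<lambda>u. l + m * u)"
  \<comment> \<open>\<open>r\<close> is \<nu> squared along the segment, expanded so that every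
    summand is positive when \<open>q * x u < 0\<close>.\<close>
  define r where "r = (\<lambda>u. (1 + q\<^sup>2 - q * x u - q * inverse (x u)) / 4)"
  define y where "y = (\<lambda>u. e * sqrt (r u))"
  define y' where "y' = (\<lambda>u. e * (((- q * m + q * m / (x u)\<^sup>2) / 4) / (2 * sqrt (r u))))"
  have qx: "q * x u < 0" if "u \<in> {0..1}" for u
  proof -
    \<comment> \<open>A convex combination of \<open>q * l\<close> and \<open>q * inverse l\<close>,
      the latter written as \<open>q * l / l\<^sup>2\<close>; both are negative.\<close>
    have "q * x u = (1 - u) * (q * l) + u * (q * l) / l\<^sup>2"
      using l0 by (simp add: x_def m_def field_simps power2_eq_square)
    moreover have "u * (q * l) / l\<^sup>2 \<le> 0" "(1 - u) * (q * l) \<le> 0"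
      using that l by (auto simp: mult_nonneg_nonpos divide_nonpos_nonneg)
    moreover have "u * (q * l) / l\<^sup>2 < 0 \<or> (1 - u) * (q * l) < 0"
      using that l l0 by (cases "u = 1") (simp_all add: mult_pos_neg divide_neg_pos)
    ultimately show ?thesis by linarith
  qed
  have x0: "x u \<noteq> 0" if "u \<in> {0..1}" for u using qx[OF that] by auto
  have qix: "q * inverse (x u) < 0" if "u \<in> {0..1}" for u
    using qx[OF that] by (simp add: mult_less_0_iff)
  have r: "r u > 0" if "u \<in> {0..1}" for u
    using qx[OF that] qix[OF that] q_sq unfolding r_def by (intro divide_pos_pos) linarith+
  have cx: "continuous_on A x" for A unfolding x_def by (intro continuous_intros)
  have cr: "continuous_on {0..1} r"
    unfolding r_def by (intro continuous_intros cx) (use x0 in auto)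
  have dx: "(x has_real_derivative m) (at u)" for u
    unfolding x_def by (auto intro!: derivative_eq_intros)
  have dr: "(r has_real_derivative (- q * m + q * m / (x u)\<^sup>2) / 4) (at u)" if "u \<in> {0..1}" for u
    unfolding r_def using x0[OF that]
    by (auto intro!: derivative_eq_intros dx simp: power2_eq_square field_simps)
  have dy: "(y has_real_derivative y' u) (at u)" if "u \<in> {0..1}" for u
    unfolding y_def y'_def using r[OF that]
    by (auto intro!: derivative_eq_intros dr[OF that] simp: field_simps)
  have cy: "continuous_on {0..1} y'"
    unfolding y'_def by (intro continuous_intros cx cr) (use x0 r in force)+
  have curve: "x u \<noteq> 0 \<and> 4 * (y u)\<^sup>2 = (x u - q) * (inverse (x u) - q)" if "u \<in> {0..1}" for u
  proof -
    have "4 * (y u)\<^sup>2 = (e * e) * (4 * r u)"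
      using r[OF that] by (simp add: y_def power_mult_distrib power2_eq_square[of e])
    also have "\<dots> = (x u - q) * (inverse (x u) - q)"
      using x0[OF that] unfolding e r_def by (simp add: field_simps power2_eq_square)
    finally show ?thesis using x0[OF that] by simp
  qed
  have x_end: "x 0 = l" "x 1 = inverse l" by (auto simp: x_def m_def)
  have n_eq: "y u = n" if "u \<in> {0..1}" "4 * (y u)\<^sup>2 = 4 * n\<^sup>2" for u
  proof -
    have "e * y u = (e * e) * sqrt (r u)" by (simp add: y_def)
    then have "e * y u > 0" using r[OF that(1)] by (simp add: e)
    moreover have "y u = n \<or> y u = - n" using that(2) by (simp add: power2_eq_iff)
    ultimately show ?thesis by (auto simp: e_def sgn_if split: if_splits)
  qed
  have y_end: "y 0 = n" "y 1 = n"
    using n_eq[of 0] n_eq[of 1] curve[of 0] curve[of 1] x_end n(2) by (auto simp: mult.commute)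
  \<comment> \<open>The factor \<open>- (q * x u)\<close> makes the denominator positive; the
    constant \<open>- (q * m / e)\<close> restores the actual integrand afterwards.\<close>
  define P where "P = (\<lambda>u. (2 * E - q * K * (x u + inverse (x u))) / (4 * pi * sqrt (r u) * - (q * x u)))"
  have P: "P u > 0" if "u \<in> {0..1}" for u
  proof -
    have "K * (q * x u) < 0" "K * (q * inverse (x u)) < 0"
      using KE qx[OF that] qix[OF that] by (simp_all only: mult_pos_neg)
    moreover have "q * K * (x u + inverse (x u)) = K * (q * x u) + K * (q * inverse (x u))"
      by (simp add: algebra_simps)
    ultimately have "2 * E - q * K * (x u + inverse (x u)) > 0" using KE by linarith
    moreover have "4 * pi * sqrt (r u) * - (q * x u) > 0"
      using r[OF that] qx[OF that] by (intro mult_pos_pos) auto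
    ultimately show ?thesis unfolding P_def by (rule divide_pos_pos)
  qed
  have cP: "continuous_on {0..1} P"
    unfolding P_def by (intro continuous_intros cx cr) (use x0 r q in force)+
  define J where "J = integral {0..1} P"
  have J: "J > 0" unfolding J_def using P less_imp_le[OF P]
    by (intro integral_pos_real[where c = 0] cP) auto
  have "(P has_integral J) {0..1}"
    unfolding J_def by (intro integrable_integral integrable_continuous_real cP)
  then have "((\<lambda>u. - (q * m / e) * P u) has_integral - (q * m / e) * J) {0..1}"
    by (rule has_integral_mult_right)
  moreover have "- (q * m / e) * P u
      = (2 * E - q * K * (x u + inverse (x u))) / (4 * pi * y u * x u) * m" if "u \<in> {0..1}" for u
    using q e by (simp add: P_def y_def ac_simps)
  ultimately have int: "((\<lambda>u. (2 * E - q * K * (x u + inverse (x u))) / (4 * pi * y u * x u) * m)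
      has_integral - (q * m / e) * J) {0..1}"
    by (rule has_integral_eq[rotated]) auto
  note path = curve_integral_real_path[OF dx continuous_on_const dy cy int[unfolded K_def E_def]]
  define g where "g = (\<lambda>u. (complex_of_real (x u), complex_of_real (y u)))"
  have "valid_path g" "Im (curve_integral g (d_omega q)) = q * m / e * J"
    using path by (simp_all add: g_def)
  moreover have "path_image g \<subseteq> punctured_curve (genus_one_radicand q)"
    using curve by (auto simp: path_image_def g_def of_real_mem_genus_one_curve)
  moreover have "pathstart g = (of_real l, of_real n)" "pathfinish g = (of_real (inverse l), of_real n)"
    using x_end y_end by (simp_all add: pathstart_def pathfinish_def g_def)
  moreover have "q * m / e * J \<noteq> 0" using J m e q by simp
  ultimately show ?thesis by (intro exI[of _ g]) simp
qed

end

section \<open>Spectral genus one\<close>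

lemma norm_exp_pi_i_eq_1_iff: "norm (exp (of_real pi * \<i> * z)) = 1 \<longleftrightarrow> Im z = 0"
  by simp

text \<open>\<open>Im (z + inverse z)\<close> equals
  \<open>Im z * (1 - 1 / (norm z)\<^sup>2)\<close>, whose second factor is nonzero off the unit
  circle.\<close>

lemma Im_add_inverse_eq_0:
  assumes "Im (z + inverse z) = 0" "norm z \<noteq> 1"
  shows "Im z = 0"
proof (rule ccontr)
  assume z: "Im z \<noteq> 0"
  then have "(Re z)\<^sup>2 + (Im z)\<^sup>2 \<noteq> 0" by (simp add: sum_power2_eq_zero_iff)
  moreover have "Im z = Im z / ((Re z)\<^sup>2 + (Im z)\<^sup>2)" using assms(1) by simp
  ultimately have "Im z * ((Re z)\<^sup>2 + (Im z)\<^sup>2) = Im z * 1" by (metis mult.right_neutral nonzero_eq_divide_eq)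
  then have "(Re z)\<^sup>2 + (Im z)\<^sup>2 = 1" using z by (metis mult_left_cancel)
  then show False using assms(2) by (simp add: cmod_def)
qed

text \<open>The integral is the difference of a value at the end and a value at the start of the
  path.\<close>

lemma multivalued_primitive_real_path:
  assumes "multivalued_primitive Y f W" "valid_path g" "path_image g \<subseteq> Y"
    and "\<And>w. w \<in> W (pathstart g) \<union> W (pathfinish g) \<Longrightarrow> Im w = 0"
  shows "Im (curve_integral g f) = 0"
proof -
  have Y: "pathstart g \<in> Y" "pathfinish g \<in> Y"
    using assms(3) by auto
  then have "W (pathstart g) \<noteq> {}"
    using assms(1) unfolding multivalued_primitive_def by blast
  then obtain w where w: "w \<in> W (pathstart g)" by blast
  then have "w + curve_integral g f \<in> W (pathfinish g)"
    using assms(1-3) Y unfolding multivalued_primitive_def by blast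
  then have "Im (w + curve_integral g f) = 0" "Im w = 0" using assms(4) w by blast+
  then show ?thesis by simp
qed

lemma equivariant_spectral_genus_one_unimodular:
  assumes "equivariant_spectral_genus_one a mu1 mu2" "(l, n) \<in> punctured_curve a" "n \<noteq> 0"
    and "norm (mu1 (l, n)) = 1" "norm (mu2 (l, n)) = 1"
  shows "norm l = 1"
proof (rule ccontr)
  assume l: "norm l \<noteq> 1"
  obtain q :: real and W and x1 x2 :: real and p1 p2 :: int
    where q: "-1 < q" "q < 1" "q \<noteq> 0" and a: "a = genus_one_radicand q" and W: "is_omega q W"
      and ind: "lin_indep_pair (x1, real_of_int p1) (x2, real_of_int p2)"
      and mu: "\<forall>(l, n) \<in> punctured_curve a. \<forall>w \<in> W (l, n).
           mu1 (l, n) = exp (of_real pi * \<i> * (of_real x1 * n + of_int p1 * w)) \<and>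
           mu2 (l, n) = exp (of_real pi * \<i> * (of_real x2 * n + of_int p2 * w))"
    using assms(1) unfolding equivariant_spectral_genus_one_def by blast
  interpret genus_one_parameter q by unfold_locales (fact q)+
  have prim: "multivalued_primitive (punctured_curve a) (d_omega q) W"
    and skew: "W (inverse l, n) = uminus ` W (l, n)"
    using W assms(2) by (force simp: is_omega_def a tau_def)+
  \<comment> \<open>The formulas for \<open>mu1\<close> and \<open>mu2\<close> hold with every value
    \<open>w\<close>, so each one yields a homogeneous system for \<open>Im n\<close> and
    \<open>Im w\<close> with independent rows.\<close>
  have real: "Im n = 0" "Im w = 0" if "w \<in> W (l, n)" for w
  proof -
    have "mu1 (l, n) = exp (of_real pi * \<i> * (of_real x1 * n + of_int p1 * w))"
      "mu2 (l, n) = exp (of_real pi * \<i> * (of_real x2 * n + of_int p2 * w))"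
      using mu assms(2) that by blast+
    then have "Im (of_real x1 * n + of_int p1 * w) = 0" "Im (of_real x2 * n + of_int p2 * w) = 0"
      using assms(4,5) norm_exp_pi_i_eq_1_iff by metis+
    then have "x1 * Im n + real_of_int p1 * Im w = 0" "x2 * Im n + real_of_int p2 * Im w = 0"
      by simp_all
    then show "Im n = 0" "Im w = 0" by (rule lin_indep_pair_det[OF ind])+
  qed
  have real': "Im w = 0" if "w \<in> W (l, n) \<union> W (inverse l, n)" for w
    using that real(2) skew by auto
  have "W (l, n) \<noteq> {}"
    using prim assms(2) unfolding multivalued_primitive_def by blast
  then obtain w where "w \<in> W (l, n)" by blast
  define y where "y = Re n"
  have n: "n = of_real y" using real(1)[OF \<open>w \<in> W (l, n)\<close>] by (simp add: y_def complex_eq_iff)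
  have l0: "l \<noteq> 0" and rad: "n\<^sup>2 = (l - of_real q) * (inverse l - of_real q) / 4"
    using assms(2) by (auto simp: punctured_curve_def a genus_one_radicand_def)
  \<comment> \<open>The curve equation expresses \<lambda> plus its inverse through \<nu> squared,
    so a real \<nu> makes this sum real.\<close>
  have "of_real q * (l + inverse l) = of_real (1 + q\<^sup>2 - 4 * y\<^sup>2)"
    using rad l0 by (simp add: n field_simps power2_eq_square)
  then have "Im (of_real q * (l + inverse l)) = 0" by (metis Im_complex_of_real)
  then have "q * Im (l + inverse l) = 0"
    by (simp only: times_complex.sel Re_complex_of_real Im_complex_of_real mult_zero_left add_0_right)
  then have "Im (l + inverse l) = 0" using q(3) by (blast dest: mult_eq_0_iff[THEN iffD1])
  then have "Im l = 0" using l by (rule Im_add_inverse_eq_0)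
  define x where "x = Re l"
  have lx: "l = of_real x" using \<open>Im l = 0\<close> by (simp add: x_def complex_eq_iff)
  have curve: "x \<noteq> 0" "4 * y\<^sup>2 = (x - q) * (inverse x - q)"
    using assms(2) unfolding a lx n of_real_mem_genus_one_curve by auto
  have y: "y \<noteq> 0" and x1: "\<bar>x\<bar> \<noteq> 1" using assms(3) l by (auto simp: n lx)
  \<comment> \<open>Either end may serve as the start: paths from \<open>x\<close> and from
    \<open>inverse x\<close> join the same two points, where all values of \<omega> are
    real.\<close>
  have no_path: False
    if path: "\<exists>g. valid_path g \<and> path_image g \<subseteq> punctured_curve (genus_one_radicand q) \<and>
      pathstart g = (of_real c, of_real y) \<and> pathfinish g = (of_real (inverse c), of_real y) \<and>
      Im (curve_integral g (d_omega q)) \<noteq> 0" and c: "c = x \<or> c = inverse x" for c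
  proof -
    obtain g where g: "valid_path g" "path_image g \<subseteq> punctured_curve a"
        "pathstart g = (of_real c, of_real y)" "pathfinish g = (of_real (inverse c), of_real y)"
        "Im (curve_integral g (d_omega q)) \<noteq> 0"
      using path unfolding a by blast
    have "W (pathstart g) \<union> W (pathfinish g) = W (l, n) \<union> W (inverse l, n)"
      using c unfolding g(3,4) lx n[symmetric] by (auto simp: Un_commute)
    then show False
      using multivalued_primitive_real_path[OF prim g(1,2)] real' g(5) by blast
  qed
  consider "q * x < 0" | "0 < q * x" "1 < \<bar>x\<bar>" | "0 < q * x" "\<bar>x\<bar> < 1"
    using q curve(1) x1 by (metis linorder_neqE_linordered_idom mult_eq_0_iff)
  then show False
  proof cases
    case 1
    with x1 y curve show False
      by (intro no_path[of x] imaginary_omega_path_off_branch_points) auto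
  next
    case 2
    with y curve show False
      by (intro no_path[of x] imaginary_omega_path_between_branch_points) auto
  next
    \<comment> \<open>The path between the branch points starts outside the unit circle, here at
      \<open>inverse x\<close>; the curve equation is symmetric under inversion.\<close>
    case 3
    then have "1 < \<bar>inverse x\<bar>" "0 < q * inverse x"
      using curve(1) by (auto simp: one_less_inverse zero_less_mult_iff)
    with y curve show False
      by (intro no_path[of "inverse x"] imaginary_omega_path_between_branch_points)
        (auto simp: mult.commute)
  qed
qed

theorem theorem2p9:
  fixes a :: "complex \<Rightarrow> complex"
    and eta :: "point \<Rightarrow> point"
    and mu1 mu2 :: "point \<Rightarrow> complex"
  assumes "equivariant_spectral_curve a eta mu1 mu2"
  shows "\<not> (\<exists>P. double_point a mu1 mu2 P \<and> fst P \<in> (UNIV - {0}) - sphere 0 1)"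
proof
  assume "\<exists>P. double_point a mu1 mu2 P \<and> fst P \<in> (UNIV - {0}) - sphere 0 1"
  then obtain l n where dp: "double_point a mu1 mu2 (l, n)" and l: "norm l \<noteq> 1"
    by (auto simp: sphere_def dist_norm)
  \<comment> \<open>As \<open>sigma\<close> negates \<nu>, being unbranched at the point means
    \<open>n \<noteq> 0\<close>.\<close>
  have "(l, n) \<in> punctured_curve a" "norm (mu1 (l, n)) = 1" "norm (mu2 (l, n)) = 1" "n \<noteq> 0"
    using dp by (auto simp: double_point_def sigma_def)
  then show False
    using assms l spectral_genus_zero_unimodular equivariant_spectral_genus_one_unimodular
    unfolding equivariant_spectral_curve_def by metis
qed

end
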